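(* Let $\alpha>-\frac12$, $a>0$ and $f\in\mathcal{D}_a(\mathbb{R})$. Then $\mathcal{F}_{B,S}^\alpha(f)$ extends to an analytic function on $\mathbb{C}$, again denoted $\mathcal{F}_{B,S}^\alpha(f)$, and there exists a constant $C>0$ such that $$|\mathcal{F}_{B,S}^\alpha(f)(z)|\le C\,e^{a|z|}\qquad\text{for all } z\in\mathbb{C}.$$
   Context: $\mathcal{D}_a(\mathbb{R})$ is the space of infinitely differentiable (complex-valued) functions on $\mathbb{R}$ with support in $[-a,a]$. For $\alpha>-\frac12$, the Bessel-Struve kernel is $S_\lambda^\alpha(x)=\frac{2\Gamma(\alpha+1)}{\sqrt\pi\,\Gamma(\alpha+\frac12)}\int_0^1(1-t^2)^{\alpha-\frac12}e^{\lambda xt}\,dt$ and the Bessel-Struve transform is $\mathcal{F}_{B,S}^\alpha(f)(\lambda)=\int_{\mathbb{R}}f(x)\,S_{-i\lambda}^\alpha(x)\,|x|^{2\alpha+1}dx$, $\lambda\in\mathbb{R}$. *)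

theory Defs
  imports "HOL-Analysis.Analysis"
begin

definition smooth :: "(real \<Rightarrow> complex) \<Rightarrow> bool" where
  "smooth f \<longleftrightarrow>
     (\<forall>n x. ((\<lambda>g y. vector_derivative g (at y)) ^^ n) f differentiable (at x))"

definition D_space :: "real \<Rightarrow> (real \<Rightarrow> complex) set" where
  "D_space a = {f. smooth f \<and> closure {x. f x \<noteq> 0} \<subseteq> {-a..a}}"

text \<open>
  The parameter \<open>\<mu>\<close> is complex because the transform evaluates the kernel at \<open>- \<i> * \<mu>\<close> for real \<open>\<mu>\<close>.
  For \<open>\<alpha> < 1/2\<close> the integrand is unbounded at \<open>t = 1\<close>, but the Lebesgue integral
  converges whenever \<open>\<alpha> > -1/2\<close>; the value \<open>0 powr (\<alpha> - 1/2) = 0\<close> taken at the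
  single point \<open>t = 1\<close> is immaterial.
\<close>

definition bessel_struve_kernel :: "real \<Rightarrow> complex \<Rightarrow> real \<Rightarrow> complex" where
  "bessel_struve_kernel \<alpha> \<mu> x =
     complex_of_real (2 * Gamma (\<alpha> + 1) / (sqrt pi * Gamma (\<alpha> + 1/2))) *
     (LINT t:{0..1}|lborel.
        complex_of_real ((1 - t^2) powr (\<alpha> - 1/2)) * exp (\<mu> * complex_of_real (x * t)))"

definition bessel_struve_transform :: "real \<Rightarrow> (real \<Rightarrow> complex) \<Rightarrow> real \<Rightarrow> complex" where
  "bessel_struve_transform \<alpha> f \<mu> =
     (LINT x|lborel.
        f x * bessel_struve_kernel \<alpha> (- \<i> * complex_of_real \<mu>) x *
        complex_of_real (\<bar>x\<bar> powr (2 * \<alpha> + 1)))"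

end

theory Submission
  imports Defs
begin

text \<open>
  Writing the kernel as an integral turns the transform into a double integral of
  \<open>W (x, t) * exp (- \<i> * z * x * t)\<close> with \<open>W\<close> integrable over the plane and supported where
  \<open>\<bar>x * t\<bar> \<le> a\<close>. Expanding the exponential and integrating termwise gives an everywhere
  convergent power series in \<open>z\<close>, and the modulus of the exponential is at most
  \<open>exp (a * \<bar>z\<bar>)\<close> on the support of \<open>W\<close>.
\<close>

text \<open>Where \<open>w = 0\<close> both sides vanish, so \<open>p\<close> has to be controlled
  only on the support of the weight; that is all the application can offer.\<close>

lemma norm_mult_exp_le:
  fixes w z p :: complex
  assumes "w \<noteq> 0 \<Longrightarrow> norm p \<le> b"
  shows "norm (w * exp (z * p)) \<le> norm w * exp (b * norm z)"
proof (cases "w = 0")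
  case False
  have "norm (exp (z * p)) \<le> exp (norm (z * p))"
    by (rule norm_exp)
  also have "\<dots> \<le> exp (b * norm z)"
    using assms[OF False] by (simp add: norm_mult mult.commute mult_right_mono)
  finally show ?thesis
    by (simp add: norm_mult mult_left_mono)
qed simp

text \<open>The theorem uses this with the plane as \<open>M\<close>,
  \<open>\<phi> (x, t) = - \<i> * (x * t)\<close> and \<open>b = a\<close>. Since
  \<open>\<phi>\<close> is bounded only where \<open>W\<close> is nonzero, it may be unbounded on
  the whole space.\<close>

context
  fixes M :: "'a measure" and W \<phi> :: "'a \<Rightarrow> complex" and b :: real
  assumes W: "integrable M W" and \<phi>: "\<phi> \<in> borel_measurable M"
    and bound: "\<And>x. W x \<noteq> 0 \<Longrightarrow> norm (\<phi> x) \<le> b" and b: "b \<ge> 0"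
begin

lemma integrable_mult_exp: "integrable M (\<lambda>x. W x * exp (z * \<phi> x))"
proof (rule Bochner_Integration.integrable_bound)
  show "integrable M (\<lambda>x. norm (W x) * exp (b * norm z))"
    using W by simp
  show "(\<lambda>x. W x * exp (z * \<phi> x)) \<in> borel_measurable M"
    using W \<phi> by measurable
  show "AE x in M. norm (W x * exp (z * \<phi> x)) \<le> norm (norm (W x) * exp (b * norm z))"
    using norm_mult_exp_le[OF bound] by simp
qed

lemma norm_integral_mult_exp_le:
  "norm (LINT x|M. W x * exp (z * \<phi> x)) \<le> (LINT x|M. norm (W x)) * exp (b * norm z)"
proof -
  have "norm (LINT x|M. W x * exp (z * \<phi> x)) \<le> (LINT x|M. norm (W x) * exp (b * norm z))"
    by (rule order_trans[OF integral_norm_bound integral_mono])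
       (use W integrable_mult_exp norm_mult_exp_le[OF bound] in auto)
  then show ?thesis
    by simp
qed

lemma norm_mult_power_le: "norm (W x * \<phi> x ^ n) \<le> norm (W x) * b ^ n"
  using bound[of x] by (cases "W x = 0") (auto simp: norm_mult norm_power mult_left_mono power_mono)

lemma integrable_mult_power: "integrable M (\<lambda>x. W x * \<phi> x ^ n)"
proof (rule Bochner_Integration.integrable_bound)
  show "integrable M (\<lambda>x. norm (W x) * b ^ n)"
    using W by simp
  show "(\<lambda>x. W x * \<phi> x ^ n) \<in> borel_measurable M"
    using W \<phi> by measurable
  show "AE x in M. norm (W x * \<phi> x ^ n) \<le> norm (norm (W x) * b ^ n)"
    using norm_mult_power_le b by simp
qed

text \<open>The L1 norms of the terms are at most those of the series for
  \<open>exp (b * norm z)\<close> times the L1 norm of \<open>W\<close>, which justifies exchanging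
  sum and integral.\<close>

lemma integral_mult_exp_sums:
  "(\<lambda>n. (LINT x|M. W x * \<phi> x ^ n) / fact n * z ^ n) sums (LINT x|M. W x * exp (z * \<phi> x))"
proof -
  define T where "T n x = W x * \<phi> x ^ n / fact n * z ^ n" for n x
  have T_int: "integrable M (T n)" for n
    unfolding T_def by (intro integrable_mult_left integrable_divide integrable_mult_power)
  have T_sums: "(\<lambda>n. T n x) sums (W x * exp (z * \<phi> x))" for x
    using sums_mult[OF exp_converges[of "z * \<phi> x"], of "W x"]
    by (simp add: T_def scaleR_conv_of_real power_mult_distrib field_simps)
  \<comment> \<open>The factor \<open>c\<close> will be \<open>norm (W x)\<close> for the pointwise
    majorant and the integral of \<open>norm (W x)\<close> for the majorant in mean.\<close>
  have exp_summable: "summable (\<lambda>n. c * ((b * norm z) ^ n / fact n))" for c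
    using summable_exp[of "b * norm z"] by (intro summable_mult) (simp add: field_simps)
  have T_le: "norm (T n x) \<le> norm (W x) * ((b * norm z) ^ n / fact n)" for n x
    using mult_right_mono[OF norm_mult_power_le[of x n], of "norm z ^ n / fact n"]
    by (simp add: T_def norm_mult norm_divide norm_power power_mult_distrib field_simps)
  have T_integral_le: "(LINT x|M. norm (T n x)) \<le> (LINT x|M. norm (W x)) * ((b * norm z) ^ n / fact n)" for n
    unfolding integral_mult_left_zero[symmetric]
    by (rule integral_mono) (use T_int W T_le in auto)
  have "(\<lambda>n. integral\<^sup>L M (T n)) sums (LINT x|M. (\<Sum>n. T n x))"
  proof (rule sums_integral)
    show "AE x in M. summable (\<lambda>n. norm (T n x))"
      using T_le by (intro AE_I2 summable_comparison_test'[OF exp_summable]) auto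
    show "summable (\<lambda>n. LINT x|M. norm (T n x))"
      by (rule summable_comparison_test'[OF exp_summable])
         (use T_integral_le in \<open>auto simp: integral_nonneg_AE\<close>)
  qed (rule T_int)
  then show ?thesis
    using T_sums[THEN sums_unique, symmetric] by (simp add: T_def[abs_def])
qed

text \<open>The coefficients do not depend on \<open>z\<close>, so this is a power series converging
  on the whole plane; termwise differentiation makes it entire.\<close>

lemma integral_mult_exp_analytic: "(\<lambda>z. LINT x|M. W x * exp (z * \<phi> x)) analytic_on UNIV"
proof -
  define c where "c n = (LINT x|M. W x * \<phi> x ^ n) / fact n" for n
  have "(\<lambda>z. \<Sum>n. c n * z ^ n) holomorphic_on UNIV"
    using termdiffs_strong_converges_everywhere[of c] integral_mult_exp_sums
    by (force simp: c_def holomorphic_on_def field_differentiable_def sums_iff)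
  moreover have "(\<Sum>n. c n * z ^ n) = (LINT x|M. W x * exp (z * \<phi> x))" for z
    using sums_unique[OF integral_mult_exp_sums[of z]] by (simp add: c_def)
  ultimately show ?thesis
    by (simp add: analytic_on_open)
qed

end

text \<open>Tonelli: the iterated integral of the norm is the product of the L1 norms of
  \<open>g\<close> and \<open>h\<close>, hence finite.\<close>

lemma (in pair_sigma_finite) integrable_mult_pair:
  fixes g :: "'a \<Rightarrow> complex" and h :: "'b \<Rightarrow> complex"
  assumes g: "integrable M1 g" and h: "integrable M2 h"
  shows "integrable (M1 \<Otimes>\<^sub>M M2) (\<lambda>(x, y). g x * h y)"
proof (rule Fubini_integrable)
  show "(\<lambda>(x, y). g x * h y) \<in> borel_measurable (M1 \<Otimes>\<^sub>M M2)"
    using borel_measurable_integrable[OF g] borel_measurable_integrable[OF h] by measurable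
qed (use g h in \<open>simp_all add: norm_mult\<close>)

lemma D_space_continuous:
  assumes "f \<in> D_space a"
  shows "continuous_on S f"
proof -
  \<comment> \<open>This is the case \<open>n = 0\<close> of \<open>smooth\<close>.\<close>
  have "f differentiable (at x)" for x
    using assms funpow_0[of "\<lambda>g y. vector_derivative g (at y)" f]
    unfolding D_space_def smooth_def by (metis (no_types, lifting) mem_Collect_eq)
  then show ?thesis
    by (simp add: continuous_at_imp_continuous_on differentiable_imp_continuous_within)
qed

lemma D_space_support:
  assumes "f \<in> D_space a" and "f x \<noteq> 0"
  shows "\<bar>x\<bar> \<le> a"
  using assms closure_subset[of "{x. f x \<noteq> 0}"] by (force simp: D_space_def)

text \<open>A continuous function with compact support is integrable; \<open>p > 0\<close> gives
  continuity of the power at the origin.\<close>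

lemma D_space_powr_integrable:
  assumes "f \<in> D_space a" and "p > 0"
  shows "integrable lborel (\<lambda>x. f x * complex_of_real (\<bar>x\<bar> powr p))"
proof -
  have "continuous_on {-a..a} (\<lambda>x. f x * complex_of_real (\<bar>x\<bar> powr p))"
    using D_space_continuous[OF assms(1)] assms(2)
    by (intro continuous_intros continuous_on_powr') auto
  then have "set_integrable lborel {-a..a} (\<lambda>x. f x * complex_of_real (\<bar>x\<bar> powr p))"
    by (rule borel_integrable_atLeastAtMost')
  also have "(\<lambda>x. indicator {-a..a} x *\<^sub>R (f x * complex_of_real (\<bar>x\<bar> powr p))) =
      (\<lambda>x. f x * complex_of_real (\<bar>x\<bar> powr p))"
    using D_space_support[OF assms(1)] by (fastforce simp: indicator_def)
  then have "set_integrable lborel {-a..a} (\<lambda>x. f x * complex_of_real (\<bar>x\<bar> powr p)) \<longleftrightarrow>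
      integrable lborel (\<lambda>x. f x * complex_of_real (\<bar>x\<bar> powr p))"
    by (simp add: set_integrable_def)
  finally show ?thesis .
qed

text \<open>In the factorization \<open>(1 + t) * (1 - t)\<close> the power of the first factor is
  bounded on the interval, and that of the second is a Beta integrand with parameters
  \<open>1\<close> and \<open>s + 1 > 0\<close>.\<close>

lemma one_minus_square_powr_integrable:
  fixes s :: real
  assumes "s > -1"
  shows "set_integrable lborel {0..1} (\<lambda>t. (1 - t\<^sup>2) powr s)"
proof -
  have *: "set_integrable lborel {0..1} (\<lambda>t::real. 2 powr \<bar>s\<bar> * (t powr (1 - 1) * (1 - t) powr ((s + 1) - 1)))"
    using assms by (intro set_integrable_mult_right integrable_Beta) auto
  show ?thesis
  proof (rule set_integrable_bound[OF *])
    show "set_borel_measurable lborel {0..1} (\<lambda>t. (1 - t\<^sup>2) powr s)"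
      unfolding set_borel_measurable_def by measurable
    \<comment> \<open>The bound fails at \<open>t = 0\<close>, where \<open>0 powr 0 = 0\<close>.\<close>
    show "AE t in lborel. t \<in> {0..1} \<longrightarrow>
        norm ((1 - t\<^sup>2) powr s) \<le> norm (2 powr \<bar>s\<bar> * (t powr (1 - 1) * (1 - t) powr ((s + 1) - 1)))"
      using AE_lborel_singleton[of "0::real"]
    proof eventually_elim
      case (elim t)
      show ?case
      proof
        assume t: "t \<in> {0..1}"
        have "(1 - t\<^sup>2) powr s = (1 + t) powr s * (1 - t) powr s"
          using t by (subst powr_mult[symmetric]) (auto simp: power2_eq_square algebra_simps)
        \<comment> \<open>Since \<open>1 + t\<close> lies between 1 and 2, passing to
          \<open>\<bar>s\<bar>\<close> covers both signs of \<open>s\<close>.\<close>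
        moreover have "(1 + t) powr s \<le> 2 powr \<bar>s\<bar>"
        proof -
          have "(1 + t) powr s \<le> (1 + t) powr \<bar>s\<bar>"
            using t by (intro powr_mono) auto
          also have "\<dots> \<le> 2 powr \<bar>s\<bar>"
            using t by (intro powr_mono2) auto
          finally show ?thesis .
        qed
        ultimately show "norm ((1 - t\<^sup>2) powr s) \<le>
            norm (2 powr \<bar>s\<bar> * (t powr (1 - 1) * (1 - t) powr ((s + 1) - 1)))"
          using elim t by (auto simp: mult_right_mono)
      qed
    qed
  qed
qed

theorem theorem4p1:
  fixes \<alpha> a :: real and f :: "real \<Rightarrow> complex"
  assumes "\<alpha> > -1/2" and "a > 0" and "f \<in> D_space a"
  shows "\<exists>F :: complex \<Rightarrow> complex.
           F analytic_on UNIV \<and>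
           (\<forall>\<mu>::real. F (complex_of_real \<mu>) = bessel_struve_transform \<alpha> f \<mu>) \<and>
           (\<exists>C::real. C > 0 \<and> (\<forall>z. norm (F z) \<le> C * exp (a * norm z)))"
proof -
  define k where "k = complex_of_real (2 * Gamma (\<alpha> + 1) / (sqrt pi * Gamma (\<alpha> + 1/2)))"
  define g where "g x = f x * complex_of_real (\<bar>x\<bar> powr (2 * \<alpha> + 1))" for x :: real
  \<comment> \<open>The indicator turns the kernel's integral over the unit interval into one over
    the line, ready for the product measure.\<close>
  define h where "h t = indicator {0..1} t *\<^sub>R complex_of_real ((1 - t^2) powr (\<alpha> - 1/2))" for t :: real
  define W where "W = (\<lambda>(x, t). g x * h t)"
  define \<phi> where "\<phi> = (\<lambda>(x, t). - \<i> * complex_of_real (x * t))"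
  define G where "G z = (LINT p|(lborel \<Otimes>\<^sub>M lborel). W p * exp (z * \<phi> p))" for z
  \<comment> \<open>Both integrability claims rest on \<open>\<alpha> > -1/2\<close>: it gives
    \<open>2 * \<alpha> + 1 > 0\<close> for \<open>g\<close> and \<open>\<alpha> - 1/2 > -1\<close>
    for \<open>h\<close>.\<close>
  have g: "integrable lborel g"
    unfolding g_def using assms by (intro D_space_powr_integrable) auto
  have h: "integrable lborel h"
  proof -
    have "integrable lborel (\<lambda>t. complex_of_real (indicator {0..1} t *\<^sub>R (1 - t^2) powr (\<alpha> - 1/2)))"
      using one_minus_square_powr_integrable[of "\<alpha> - 1/2"] assms(1)
      unfolding set_integrable_def by (intro integrable_of_real) auto
    then show ?thesis
      by (simp add: h_def[abs_def] scaleR_conv_of_real)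
  qed
  have W: "integrable (lborel \<Otimes>\<^sub>M lborel) W"
    unfolding W_def by (rule lborel_pair.integrable_mult_pair[OF g h])
  have \<phi>: "\<phi> \<in> borel_measurable (lborel \<Otimes>\<^sub>M lborel)"
    unfolding \<phi>_def by measurable
  \<comment> \<open>The exponential type \<open>a\<close> arises here:
    \<open>\<bar>x\<bar> \<le> a\<close> on the support of \<open>f\<close>, and \<open>t\<close> is
    at most 1.\<close>
  have bound: "norm (\<phi> p) \<le> a" if "W p \<noteq> 0" for p
  proof (cases p)
    case (Pair x t)
    with that have "f x \<noteq> 0" "t \<in> {0..1}"
      by (auto simp: W_def g_def h_def indicator_def split: if_splits)
    then have "\<bar>x\<bar> * \<bar>t\<bar> \<le> a * 1"
      using D_space_support[OF assms(3)] assms(2) by (intro mult_mono) auto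
    with Pair show ?thesis
      by (simp add: \<phi>_def norm_mult abs_mult)
  qed
  note facts = W \<phi> bound less_imp_le[OF assms(2)]
  have "(\<lambda>z. k * G z) analytic_on UNIV"
    unfolding G_def by (intro analytic_intros integral_mult_exp_analytic[OF facts])
  moreover have "k * G (complex_of_real \<mu>) = bessel_struve_transform \<alpha> f \<mu>" for \<mu> :: real
  proof -
    \<comment> \<open>Fubini recovers the transform: the inner integral over \<open>t\<close> is the
      kernel up to the factors \<open>k\<close> and \<open>g x\<close>.\<close>
    have "G (complex_of_real \<mu>) = (LINT x|lborel. LINT t|lborel. W (x, t) * exp (complex_of_real \<mu> * \<phi> (x, t)))"
      unfolding G_def
      by (rule lborel_pair.integral_fst'[symmetric, OF integrable_mult_exp[OF facts]])
    also have "k * \<dots> = (LINT x|lborel. k * (LINT t|lborel. W (x, t) * exp (complex_of_real \<mu> * \<phi> (x, t))))"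
      by simp
    also have "\<dots> = bessel_struve_transform \<alpha> f \<mu>"
      unfolding bessel_struve_transform_def
    proof (rule Bochner_Integration.integral_cong[OF refl])
      fix x :: real
      have "(LINT t|lborel. W (x, t) * exp (complex_of_real \<mu> * \<phi> (x, t))) =
          g x * (LINT t|lborel. indicator {0..1} t *\<^sub>R (complex_of_real ((1 - t^2) powr (\<alpha> - 1/2)) *
             exp (- \<i> * complex_of_real \<mu> * complex_of_real (x * t))))"
        unfolding integral_mult_right_zero[symmetric]
        by (intro Bochner_Integration.integral_cong)
           (simp_all add: W_def \<phi>_def h_def mult_ac)
      then show "k * (LINT t|lborel. W (x, t) * exp (complex_of_real \<mu> * \<phi> (x, t))) =
          f x * bessel_struve_kernel \<alpha> (- \<i> * complex_of_real \<mu>) x * complex_of_real (\<bar>x\<bar> powr (2 * \<alpha> + 1))"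
        unfolding bessel_struve_kernel_def k_def[symmetric] by (simp add: g_def set_lebesgue_integral_def mult_ac)
    qed
    finally show ?thesis .
  qed
  \<comment> \<open>The added 1 keeps the constant positive even when the integral of
    \<open>norm (W p)\<close> is zero, as for \<open>f = 0\<close>.\<close>
  moreover have "norm (k * G z) \<le> (norm k * (LINT p|(lborel \<Otimes>\<^sub>M lborel). norm (W p)) + 1) * exp (a * norm z)" for z
    using mult_left_mono[OF norm_integral_mult_exp_le[OF facts, of z], of "norm k"]
    by (simp add: G_def norm_mult algebra_simps add_increasing)
  moreover have "norm k * (LINT p|(lborel \<Otimes>\<^sub>M lborel). norm (W p)) + 1 > 0"
    by (intro add_nonneg_pos mult_nonneg_nonneg) (auto simp: integral_nonneg_AE)
  ultimately show ?thesis
    by blast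
qed

end
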